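(* Let $(\Phi,\mathfrak N,\mathfrak T,\mathfrak R,\mathfrak S,\phi_{\mathrm{start}},\Sigma,\mathrm{Lex},\mathrm{Sel})$ be a parameterized local lexing, $D\in\Sigma^*$, $0\le k\le|D|$, $T$ a set of parameterized tokens, $I$ a set of parameterized items and $I'$ a set of ordinary items of the induced grammar. If $I\sim I'$, then $\mathrm{Scan}\,T\,k\,I\sim\mathrm{Scan}'\,\mathcal U(T)\,k\,I'$.
   Context: $\Phi$ is a non-empty set; $\mathfrak N,\mathfrak T$ disjoint sets of nonterminals and terminals; $\mathfrak S\in\mathfrak N$, $\phi_{\mathrm{start}}\in\Phi$; $\mathfrak R$ a set of parameterized rules $N_{f_{k+1}}\to X_1^{f_1}\cdots X_k^{f_k}$ ($k\ge0$, $N\in\mathfrak N$, $X_i\in\mathfrak N\cup\mathfrak T$, partial $f_i:\Phi^{2i-1}\rightharpoonup\Phi$); $\Sigma$ a set of characters; $\mathrm{Lex},\mathrm{Sel}$ not needed here. A parameterized token is an element $(t,\alpha,\beta,c)$ of $\mathfrak T\times\Phi\times\Phi\times\Sigma^*$ with $k+|c|\le|D|$ whenever it is used at position $k$ (as produced by the lexer). Sequences indexed from 0; juxtaposition is concatenation; $\mathrm{take}_n$ takes the first $n$ entries. $\langle f_1,\dots,f_u\rangle$ is the set of $\rho\in\Phi^{2u}$ with $f_i$ defined at $(\rho_0,\dots,\rho_{2i-2})$ and $\rho_{2i-1}=f_i(\rho_0,\dots,\rho_{2i-2})$ for $i=1,\dots,u$. Induced grammar: nonterminals $(\mathfrak N\times\Phi\times\Phi)\cup\{\top,\bot\}$,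 terminals $\overline{\mathfrak T}=\mathfrak T\times\Phi\times\Phi$, triples written $X^\alpha_\beta$; rules $\overline{\mathfrak R}=\{\top\to\mathfrak S^{\phi_{\mathrm{start}}}_\beta\mid\beta\in\Phi\}\cup\bigcup_{r\in\mathfrak R}\overline r$, where for $r=N_{f_{k+1}}\to X_1^{f_1}\cdots X_k^{f_k}$, $\overline r$ consists of (i) rules $N^\alpha_\beta\to(X_1)^{\alpha_1}_{\beta_1}\cdots(X_k)^{\alpha_k}_{\beta_k}$ with $(\alpha,\alpha_1,\beta_1,\dots,\alpha_k,\beta_k,\beta)\in\langle f_1,\dots,f_{k+1}\rangle$, and (ii) rules $N^\alpha_\beta\to(X_1)^{\alpha_1}_{\beta_1}\cdots(X_h)^{\alpha_h}_{\beta_h}\bot$ with $1\le h\le k$, $\beta,\beta_h\in\Phi$, $(\alpha,\alpha_1,\beta_1,\dots,\alpha_h)\in\langle f_1,\dots,f_h\rangle$ and $f_{h+1}$ undefined at $(\alpha,\alpha_1,\beta_1,\dots,\alpha_h,\beta_h)$. $\mathcal U(t,\alpha,\beta,c)=(t^\alpha_\beta,c)$, lifted to sets. Items: parameterized item $(r,d,i,j,\rho)$ with $r=N_{f_{v+1}}\to X_1^{f_1}\cdots X_v^{f_v}\in\mathfrak R$, $0\le d\le v$, $0\le i\le j\le|D|$, $\rho\in\langle f_1,\dots,f_{d+1}\rangle$. Ordinary item $(q,d,i,j)$ with $q=(L\to w)\in\overline{\mathfrak R}$, $0\le d\le|w|$, $0\le i\le j\le|D|$, written $(L\to w_1\bullet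 w_2,i,j)$, $|w_1|=d$. For $x=(r,d,i,j,\rho)$, $\overline x$ consists of all $(q,d,i,j)$ with $q\in\overline r$ of type (i) and $\mathrm{take}_{2(d+1)}(\alpha,\alpha_1,\beta_1,\dots,\alpha_k,\beta_k,\beta)=\rho$, and all $(q,d,i,j)$ with $q\in\overline r$ of type (ii), $d\le h-1$, $\mathrm{take}_{2(d+1)}(\alpha,\alpha_1,\beta_1,\dots,\alpha_h)=\rho$. $\overline I=\bigcup_{x\in I}\overline x$; $\mathrm{Norm}(I')=\{(L\to w_1\bullet w_2,i,j)\in I'\mid L\ne\top,\ w_2\text{ is not the one-symbol string }\bot\}$; $I\sim I'$ means $\overline I=\mathrm{Norm}(I')$. $\mathrm{Scan}\,T\,k\,I=I\cup\{(r,d+1,i,k+|c|,\rho'\,f_{d+2}(\rho'))\mid(r,d,i,k,\rho)\in I,\ r=N_{f_{v+1}}\to X_1^{f_1}\cdots X_v^{f_v},\ d<v,\ (X_{d+1},\rho_{2d+1},\beta,c)\in T,\ \rho'=\rho\,\beta,\ f_{d+2}\text{ defined at }\rho'\}$. $\mathrm{Scan}'\,T'\,k\,I'=I'\cup\{(L\to a\,t\bullet b,i,k+|c|)\mid(L\to a\bullet t\,b,i,k)\in I',\ (t,c)\in T'\}$. *)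

theory Defs
  imports Main
begin

text \<open>
  A rule with left-hand side \<open>N\<close> and right-hand side \<open>X\<^sub>1, \<dots>, X\<^sub>k\<close> carries \<open>k + 1\<close> partial
  functions. The functions \<open>f\<^sub>1, \<dots>, f\<^sub>k\<close> are stored with their symbols, \<open>f\<^bsub>k+1\<^esub>\<close> separately.
  Elements of a power of \<open>\<Phi>\<close> are lists, so a partial function of any arity has type
  \<open>'p list \<rightharpoonup> 'p\<close>.
\<close>

record ('s, 'p) prule =
  lhs :: 's
  rhs :: "('s \<times> ('p list \<rightharpoonup> 'p)) list"
  res :: "'p list \<rightharpoonup> 'p"

definition syms :: "('s, 'p) prule \<Rightarrow> 's list" where
  "syms r = map fst (rhs r)"

text \<open>Lists are indexed from 0: \<open>X\<^sub>i\<close> is \<open>syms r ! (i - 1)\<close> and \<open>f\<^sub>i\<close> is \<open>funs r ! (i - 1)\<close>.\<close>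

definition funs :: "('s, 'p) prule \<Rightarrow> ('p list \<rightharpoonup> 'p) list" where
  "funs r = map snd (rhs r) @ [res r]"

record ('s, 'p, 'c) pgrammar =
  params :: "'p set"
  nonterms :: "'s set"
  terms :: "'s set"
  prules :: "('s, 'p) prule set"
  start :: 's
  start_param :: 'p
  chars :: "'c set"

definition partial_fun :: "'p set \<Rightarrow> nat \<Rightarrow> ('p list \<rightharpoonup> 'p) \<Rightarrow> bool" where
  "partial_fun \<Phi> n f \<longleftrightarrow> dom f \<subseteq> {\<rho> \<in> lists \<Phi>. length \<rho> = n} \<and> ran f \<subseteq> \<Phi>"

definition wf_prule :: "('s, 'p, 'c) pgrammar \<Rightarrow> ('s, 'p) prule \<Rightarrow> bool" where
  "wf_prule G r \<longleftrightarrow>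
     lhs r \<in> nonterms G \<and> set (syms r) \<subseteq> nonterms G \<union> terms G \<and>
     (\<forall>i \<in> {1..length (rhs r) + 1}. partial_fun (params G) (2 * i - 1) (funs r ! (i - 1)))"

definition wf_pgrammar :: "('s, 'p, 'c) pgrammar \<Rightarrow> bool" where
  "wf_pgrammar G \<longleftrightarrow>
     params G \<noteq> {} \<and> nonterms G \<inter> terms G = {} \<and>
     start G \<in> nonterms G \<and> start_param G \<in> params G \<and> (\<forall>r \<in> prules G. wf_prule G r)"

text \<open>The set \<open>\<langle>f\<^sub>1, \<dots>, f\<^sub>u\<rangle>\<close>.\<close>

definition chain :: "'p set \<Rightarrow> ('p list \<rightharpoonup> 'p) list \<Rightarrow> 'p list set" where
  "chain \<Phi> fs =
     {\<rho> \<in> lists \<Phi>. length \<rho> = 2 * length fs \<and>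
        (\<forall>i \<in> {1..length fs}. (fs ! (i - 1)) (take (2 * i - 1) \<rho>) = Some (\<rho> ! (2 * i - 1)))}"

text \<open>\<open>Sym X \<alpha> \<beta>\<close> is the triple with symbol \<open>X\<close>, superscript \<open>\<alpha>\<close> and subscript \<open>\<beta>\<close>.\<close>

datatype ('s, 'p) isym = Sym 's 'p 'p | Top | Bot

record 'x grammar =
  g_nonterms :: "'x set"
  g_terms :: "'x set"
  g_rules :: "('x \<times> 'x list) set"

text \<open>
  The parameters of an induced rule are given as \<open>\<alpha>\<close>, the list of pairs
  \<open>ps = [(\<alpha>\<^sub>1, \<beta>\<^sub>1), (\<alpha>\<^sub>2, \<beta>\<^sub>2), \<dots>]\<close>, and \<open>\<beta>\<close>.
\<close>

definition flat :: "('p \<times> 'p) list \<Rightarrow> 'p list" where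
  "flat ps = concat (map (\<lambda>(a, b). [a, b]) ps)"

text \<open>
  If \<open>ps\<close> is shorter than the right-hand side, \<open>map2\<close> truncates, so only the first
  \<open>length ps\<close> symbols are annotated.
\<close>

definition annotate :: "('s, 'p) prule \<Rightarrow> ('p \<times> 'p) list \<Rightarrow> ('s, 'p) isym list" where
  "annotate r ps = map2 (\<lambda>X (a, b). Sym X a b) (syms r) ps"

text \<open>
  Rules of type (i), where \<open>length ps = k\<close>. The parameter tuple
  \<open>(\<alpha>, \<alpha>\<^sub>1, \<beta>\<^sub>1, \<dots>, \<alpha>\<^sub>k, \<beta>\<^sub>k, \<beta>)\<close> is \<open>full_tuple \<alpha> ps \<beta>\<close>.
\<close>

definition full_tuple :: "'p \<Rightarrow> ('p \<times> 'p) list \<Rightarrow> 'p \<Rightarrow> 'p list" where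
  "full_tuple \<alpha> ps \<beta> = \<alpha> # flat ps @ [\<beta>]"

definition full_rule ::
  "('s, 'p) prule \<Rightarrow> 'p \<Rightarrow> ('p \<times> 'p) list \<Rightarrow> 'p \<Rightarrow> ('s, 'p) isym \<times> ('s, 'p) isym list" where
  "full_rule r \<alpha> ps \<beta> = (Sym (lhs r) \<alpha> \<beta>, annotate r ps)"

definition full_params ::
  "'p set \<Rightarrow> ('s, 'p) prule \<Rightarrow> ('p \<times> ('p \<times> 'p) list \<times> 'p) set" where
  "full_params \<Phi> r =
     {(\<alpha>, ps, \<beta>). length ps = length (rhs r) \<and> full_tuple \<alpha> ps \<beta> \<in> chain \<Phi> (funs r)}"

text \<open>
  Rules of type (ii), where \<open>length ps = h\<close>. The tuple \<open>(\<alpha>, \<alpha>\<^sub>1, \<beta>\<^sub>1, \<dots>, \<alpha>\<^sub>h)\<close>, which omits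
  \<open>\<beta>\<^sub>h\<close>, is \<open>bot_tuple \<alpha> ps\<close>.
\<close>

definition bot_tuple :: "'p \<Rightarrow> ('p \<times> 'p) list \<Rightarrow> 'p list" where
  "bot_tuple \<alpha> ps = \<alpha> # butlast (flat ps)"

definition bot_rule ::
  "('s, 'p) prule \<Rightarrow> 'p \<Rightarrow> ('p \<times> 'p) list \<Rightarrow> 'p \<Rightarrow> ('s, 'p) isym \<times> ('s, 'p) isym list" where
  "bot_rule r \<alpha> ps \<beta> = (Sym (lhs r) \<alpha> \<beta>, annotate r ps @ [Bot])"

definition bot_params ::
  "'p set \<Rightarrow> ('s, 'p) prule \<Rightarrow> ('p \<times> ('p \<times> 'p) list \<times> 'p) set" where
  "bot_params \<Phi> r =
     {(\<alpha>, ps, \<beta>). 1 \<le> length ps \<and> length ps \<le> length (rhs r) \<and>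
        \<beta> \<in> \<Phi> \<and> snd (last ps) \<in> \<Phi> \<and>
        bot_tuple \<alpha> ps \<in> chain \<Phi> (take (length ps) (funs r)) \<and>
        (funs r ! length ps) (\<alpha> # flat ps) = None}"

definition induced_rules_of ::
  "'p set \<Rightarrow> ('s, 'p) prule \<Rightarrow> (('s, 'p) isym \<times> ('s, 'p) isym list) set" where
  "induced_rules_of \<Phi> r =
     {full_rule r \<alpha> ps \<beta> | \<alpha> ps \<beta>. (\<alpha>, ps, \<beta>) \<in> full_params \<Phi> r} \<union>
     {bot_rule r \<alpha> ps \<beta> | \<alpha> ps \<beta>. (\<alpha>, ps, \<beta>) \<in> bot_params \<Phi> r}"

definition induced_grammar :: "('s, 'p, 'c) pgrammar \<Rightarrow> ('s, 'p) isym grammar" where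
  "induced_grammar G =
     \<lparr> g_nonterms = {Sym N \<alpha> \<beta> | N \<alpha> \<beta>. N \<in> nonterms G \<and> \<alpha> \<in> params G \<and> \<beta> \<in> params G} \<union> {Top, Bot},
       g_terms = {Sym t \<alpha> \<beta> | t \<alpha> \<beta>. t \<in> terms G \<and> \<alpha> \<in> params G \<and> \<beta> \<in> params G},
       g_rules = {(Top, [Sym (start G) (start_param G) \<beta>]) | \<beta>. \<beta> \<in> params G} \<union>
                 (\<Union>r \<in> prules G. induced_rules_of (params G) r) \<rparr>"

text \<open>The parameterized tokens that may be used at position \<open>k\<close> of an input of length \<open>n\<close>.\<close>

definition ptokens :: "('s, 'p, 'c) pgrammar \<Rightarrow> nat \<Rightarrow> nat \<Rightarrow> ('s \<times> 'p \<times> 'p \<times> 'c list) set" where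
  "ptokens G n k =
     {(t, \<alpha>, \<beta>, c). t \<in> terms G \<and> \<alpha> \<in> params G \<and> \<beta> \<in> params G \<and> c \<in> lists (chars G) \<and>
        k + length c \<le> n}"

definition unparam :: "('s \<times> 'p \<times> 'p \<times> 'c list) set \<Rightarrow> (('s, 'p) isym \<times> 'c list) set" where
  "unparam T = (\<lambda>(t, \<alpha>, \<beta>, c). (Sym t \<alpha> \<beta>, c)) ` T"

type_synonym ('s, 'p) pitem = "('s, 'p) prule \<times> nat \<times> nat \<times> nat \<times> 'p list"

definition pitems :: "('s, 'p, 'c) pgrammar \<Rightarrow> nat \<Rightarrow> ('s, 'p) pitem set" where
  "pitems G n =
     {(r, d, i, j, \<rho>). r \<in> prules G \<and> d \<le> length (rhs r) \<and> i \<le> j \<and> j \<le> n \<and>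
        \<rho> \<in> chain (params G) (take (d + 1) (funs r))}"

text \<open>\<open>((L, w\<^sub>1 @ w\<^sub>2), length w\<^sub>1, i, j)\<close> is the item \<open>(L \<rightarrow> w\<^sub>1 \<bullet> w\<^sub>2, i, j)\<close>.\<close>

type_synonym 'x item = "('x \<times> 'x list) \<times> nat \<times> nat \<times> nat"

definition items :: "'x grammar \<Rightarrow> nat \<Rightarrow> 'x item set" where
  "items H n =
     {((L, w), d, i, j). (L, w) \<in> g_rules H \<and> d \<le> length w \<and> i \<le> j \<and> j \<le> n}"

text \<open>In the second set below, \<open>d < length ps\<close> is the condition \<open>d \<le> h - 1\<close>.\<close>

definition item_bar :: "'p set \<Rightarrow> ('s, 'p) pitem \<Rightarrow> ('s, 'p) isym item set" where
  "item_bar \<Phi> = (\<lambda>(r, d, i, j, \<rho>).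
     {(full_rule r \<alpha> ps \<beta>, d, i, j) | \<alpha> ps \<beta>.
        (\<alpha>, ps, \<beta>) \<in> full_params \<Phi> r \<and> take (2 * (d + 1)) (full_tuple \<alpha> ps \<beta>) = \<rho>} \<union>
     {(bot_rule r \<alpha> ps \<beta>, d, i, j) | \<alpha> ps \<beta>.
        (\<alpha>, ps, \<beta>) \<in> bot_params \<Phi> r \<and> d < length ps \<and>
        take (2 * (d + 1)) (bot_tuple \<alpha> ps) = \<rho>})"

definition items_bar :: "'p set \<Rightarrow> ('s, 'p) pitem set \<Rightarrow> ('s, 'p) isym item set" where
  "items_bar \<Phi> I = (\<Union>x \<in> I. item_bar \<Phi> x)"

definition Norm :: "('s, 'p) isym item set \<Rightarrow> ('s, 'p) isym item set" where
  "Norm I' = {((L, w\<^sub>1 @ w\<^sub>2), length w\<^sub>1, i, j) | L w\<^sub>1 w\<^sub>2 i j.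
     ((L, w\<^sub>1 @ w\<^sub>2), length w\<^sub>1, i, j) \<in> I' \<and> L \<noteq> Top \<and> w\<^sub>2 \<noteq> [Bot]}"

definition similar ::
  "'p set \<Rightarrow> ('s, 'p) pitem set \<Rightarrow> ('s, 'p) isym item set \<Rightarrow> bool" where
  "similar \<Phi> I I' \<longleftrightarrow> items_bar \<Phi> I = Norm I'"

definition pScan ::
  "('s \<times> 'p \<times> 'p \<times> 'c list) set \<Rightarrow> nat \<Rightarrow> ('s, 'p) pitem set \<Rightarrow> ('s, 'p) pitem set" where
  "pScan T k I = I \<union>
     {(r, d + 1, i, k + length c, \<rho>' @ [\<gamma>]) | r d i \<rho> \<beta> c \<rho>' \<gamma>.
        (r, d, i, k, \<rho>) \<in> I \<and> d < length (rhs r) \<and>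
        (syms r ! d, \<rho> ! (2 * d + 1), \<beta>, c) \<in> T \<and>
        \<rho>' = \<rho> @ [\<beta>] \<and> (funs r ! (d + 1)) \<rho>' = Some \<gamma>}"

definition Scan :: "('x \<times> 'c list) set \<Rightarrow> nat \<Rightarrow> 'x item set \<Rightarrow> 'x item set" where
  "Scan T' k I' = I' \<union>
     {((L, a @ [t] @ b), length (a @ [t]), i, k + length c) | L a t b i c.
        ((L, a @ [t] @ b), length a, i, k) \<in> I' \<and> (t, c) \<in> T'}"

end

theory Submission
  imports Defs
begin

text \<open>
  Every ordinary rule induced from \<open>r\<close> comes with a parameter tuple \<open>\<tau>\<close> of even length, and
  \<open>\<rho>\<close> in a parameterized item \<open>(r, d, i, j, \<rho>)\<close> is the prefix of \<open>\<tau>\<close> of length \<open>2d + 2\<close>.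
  As long as \<open>\<tau>\<close> has two further entries \<open>\<beta>, \<gamma>\<close>, the symbol after the dot is determined by the
  last entry of \<open>\<rho>\<close> and by \<open>\<beta>\<close>, and \<open>\<gamma>\<close> is forced to be the value of the next function, so
  the two scans make the same step. If \<open>\<tau>\<close> is exhausted, an ordinary scan can only move the dot
  directly in front of a final \<open>\<bottom>\<close>, and \<open>Norm\<close> discards the result.
\<close>

section \<open>Lengths and entries of parameter tuples\<close>

lemma length_flat [simp]: "length (flat ps) = 2 * length ps"
  by (induction ps) (auto simp: flat_def)

lemma nth_flat:
  assumes "d < length ps"
  shows "flat ps ! (2 * d) = fst (ps ! d)" "flat ps ! Suc (2 * d) = snd (ps ! d)"
  using assms
proof (induction ps arbitrary: d)
  case (Cons p ps)
  have flat_Cons: "flat (p # ps) = fst p # snd p # flat ps"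
    by (simp add: flat_def split: prod.split)
  {
    case 1
    then show ?case using Cons.IH by (cases d) (auto simp: flat_Cons)
  next
    case 2
    then show ?case using Cons.IH by (cases d) (auto simp: flat_Cons)
  }
qed simp_all

lemma length_full_tuple [simp]: "length (full_tuple \<alpha> ps \<beta>) = 2 * length ps + 2"
  by (simp add: full_tuple_def)

text \<open>For empty \<open>ps\<close> the length would be 1, since \<open>butlast []\<close> is
  empty and \<alpha> remains; rules of type (ii) have h \<ge> 1.\<close>

lemma length_bot_tuple: "ps \<noteq> [] \<Longrightarrow> length (bot_tuple \<alpha> ps) = 2 * length ps"
  by (cases ps) (simp_all add: bot_tuple_def)

lemma nth_full_tuple:
  assumes "d < length ps"
  shows "full_tuple \<alpha> ps \<beta> ! (2 * d + 1) = fst (ps ! d)"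
    and "full_tuple \<alpha> ps \<beta> ! (2 * d + 2) = snd (ps ! d)"
  using assms nth_flat[OF assms] by (simp_all add: full_tuple_def nth_append)

text \<open>The bound is \<open>Suc d\<close> because \<open>butlast\<close> has removed the second
  component of the last pair.\<close>

lemma nth_bot_tuple:
  assumes "Suc d < length ps"
  shows "bot_tuple \<alpha> ps ! (2 * d + 1) = fst (ps ! d)"
    and "bot_tuple \<alpha> ps ! (2 * d + 2) = snd (ps ! d)"
  using assms nth_flat[of d ps] by (simp_all add: bot_tuple_def nth_butlast)

lemma length_syms [simp]: "length (syms r) = length (rhs r)"
  by (simp add: syms_def)

lemma length_funs [simp]: "length (funs r) = length (rhs r) + 1"
  by (simp add: funs_def)

lemma length_annotate [simp]:
  "length (annotate r ps) = min (length (rhs r)) (length ps)"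
  by (simp add: annotate_def)

lemma nth_annotate:
  "d < length (rhs r) \<Longrightarrow> d < length ps \<Longrightarrow>
     annotate r ps ! d = Sym (syms r ! d) (fst (ps ! d)) (snd (ps ! d))"
  by (simp add: annotate_def split: prod.split)

lemma Bot_notin_annotate: "Bot \<notin> set (annotate r ps)"
  by (auto simp: annotate_def)

lemma length_chain: "\<rho> \<in> chain \<Phi> fs \<Longrightarrow> length \<rho> = 2 * length fs"
  by (simp add: chain_def)

text \<open>Shifts the index range of \<open>chain\<close>, which starts at 1, to list positions
  starting at 0.\<close>

lemma chain_nth:
  assumes "\<rho> \<in> chain \<Phi> fs" "d < length fs"
  shows "(fs ! d) (take (2 * d + 1) \<rho>) = Some (\<rho> ! (2 * d + 1))"
proof -
  have "Suc d \<in> {1..length fs}" using assms(2) by simp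
  with assms(1) have "(fs ! (Suc d - 1)) (take (2 * Suc d - 1) \<rho>) = Some (\<rho> ! (2 * Suc d - 1))"
    unfolding chain_def by blast
  then show ?thesis by simp
qed

section \<open>Induced rules paired with their parameter tuples\<close>

text \<open>The tuple has length \<open>2 * k + 2\<close> in type (i) and \<open>2 * h\<close> in
  type (ii). With the tuple recorded beside the rule, both types are treated alike by comparing
  \<open>length \<tau>\<close> with the dot position.\<close>

definition expansion ::
  "'p set \<Rightarrow> ('s, 'p) prule \<Rightarrow> ((('s, 'p) isym \<times> ('s, 'p) isym list) \<times> 'p list) set" where
  "expansion \<Phi> r =
     {(full_rule r \<alpha> ps \<beta>, full_tuple \<alpha> ps \<beta>) | \<alpha> ps \<beta>. (\<alpha>, ps, \<beta>) \<in> full_params \<Phi> r} \<union>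
     {(bot_rule r \<alpha> ps \<beta>, bot_tuple \<alpha> ps) | \<alpha> ps \<beta>. (\<alpha>, ps, \<beta>) \<in> bot_params \<Phi> r}"

lemma expansion_cases [consumes 1, case_names full bot]:
  assumes "(q, \<tau>) \<in> expansion \<Phi> r"
  obtains \<alpha> ps \<beta> where "q = (Sym (lhs r) \<alpha> \<beta>, annotate r ps)" "\<tau> = full_tuple \<alpha> ps \<beta>"
      "length ps = length (rhs r)" "\<tau> \<in> chain \<Phi> (funs r)"
    | \<alpha> ps \<beta> where "q = (Sym (lhs r) \<alpha> \<beta>, annotate r ps @ [Bot])" "\<tau> = bot_tuple \<alpha> ps"
      "ps \<noteq> []" "length ps \<le> length (rhs r)" "\<tau> \<in> chain \<Phi> (take (length ps) (funs r))"
  using assms unfolding expansion_def full_params_def bot_params_def full_rule_def bot_rule_def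
  by fastforce

text \<open>
  The bound \<open>d < length ps\<close> for rules of type (ii) is implied by the length of \<open>\<rho>\<close>.
\<close>

lemma item_bar_expansion:
  assumes "length \<rho> = 2 * d + 2"
  shows "item_bar \<Phi> (r, d, i, j, \<rho>) =
    {(q, d, i, j) | q \<tau>. (q, \<tau>) \<in> expansion \<Phi> r \<and> take (2 * d + 2) \<tau> = \<rho>}"
proof -
  have "d < length ps"
    if "(\<alpha>, ps, \<beta>) \<in> bot_params \<Phi> r" "take (2 * d + 2) (bot_tuple \<alpha> ps) = \<rho>" for \<alpha> ps \<beta>
  proof -
    have "ps \<noteq> []" using that(1) by (auto simp: bot_params_def)
    moreover have "2 * d + 2 \<le> length (bot_tuple \<alpha> ps)"
      using arg_cong[OF that(2), of length] assms by simp
    ultimately show ?thesis using length_bot_tuple[of ps \<alpha>] by simp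
  qed
  then have "{(bot_rule r \<alpha> ps \<beta>, d, i, j) | \<alpha> ps \<beta>. (\<alpha>, ps, \<beta>) \<in> bot_params \<Phi> r \<and>
        d < length ps \<and> take (2 * (d + 1)) (bot_tuple \<alpha> ps) = \<rho>} =
      {(bot_rule r \<alpha> ps \<beta>, d, i, j) | \<alpha> ps \<beta>. (\<alpha>, ps, \<beta>) \<in> bot_params \<Phi> r \<and>
        take (2 * d + 2) (bot_tuple \<alpha> ps) = \<rho>}"
    unfolding distrib_left mult_1_right by blast
  moreover have "2 * (d + 1) = 2 * d + 2" by simp
  ultimately show ?thesis unfolding item_bar_def expansion_def prod.case by (simp only:) blast
qed

text \<open>Parity guarantees that a tuple longer than \<open>2 * d + 2\<close> has two more
  entries, not just one.\<close>

lemma expansion_even: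
  assumes "(q, \<tau>) \<in> expansion \<Phi> r"
  shows "even (length \<tau>)"
  using assms by (cases rule: expansion_cases) (simp_all add: length_bot_tuple)

lemma expansion_lhs:
  assumes "(q, \<tau>) \<in> expansion \<Phi> r"
  shows "fst q \<noteq> Top"
  using assms by (cases rule: expansion_cases) simp_all

text \<open>The length bound means \<open>d < k\<close> in type (i) and \<open>d + 1 < h\<close> in
  type (ii), so the symbol at \<open>d\<close> is annotated and its subscript is not the omitted
  \<beta> of the last pair. The value of the next function is the chain condition at
  \<open>d + 1\<close>. Past \<open>d\<close>, type (i) has no \<open>Bot\<close> and type (ii)
  still has at least two symbols.\<close>

lemma expansion_step:
  assumes "(q, \<tau>) \<in> expansion \<Phi> r" "2 * d + 4 \<le> length \<tau>"
  shows "d < length (rhs r)"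
    and "d < length (snd q)"
    and "snd q ! d = Sym (syms r ! d) (\<tau> ! (2 * d + 1)) (\<tau> ! (2 * d + 2))"
    and "(funs r ! (d + 1)) (take (2 * d + 3) \<tau>) = Some (\<tau> ! (2 * d + 3))"
    and "drop (Suc d) (snd q) \<noteq> [Bot]"
proof -
  have "d < length (rhs r) \<and> d < length (snd q) \<and>
    snd q ! d = Sym (syms r ! d) (\<tau> ! (2 * d + 1)) (\<tau> ! (2 * d + 2)) \<and>
    (funs r ! (d + 1)) (take (2 * d + 3) \<tau>) = Some (\<tau> ! (2 * d + 3)) \<and>
    drop (Suc d) (snd q) \<noteq> [Bot]"
    using assms(1)
  proof (cases rule: expansion_cases)
    case (full \<alpha> ps \<beta>)
    have d: "d < length ps" using full assms(2) by simp
    have "Bot \<notin> set (drop (Suc d) (snd q))"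
      using full Bot_notin_annotate[of r ps] by (auto dest: in_set_dropD)
    then have "drop (Suc d) (snd q) \<noteq> [Bot]" by auto
    moreover have "(funs r ! (d + 1)) (take (2 * d + 3) \<tau>) = Some (\<tau> ! (2 * d + 3))"
      using chain_nth[OF full(4), of "d + 1"] d full(3) by (simp add: eval_nat_numeral)
    ultimately show ?thesis
      using d full by (simp add: nth_annotate nth_full_tuple[simplified])
  next
    case (bot \<alpha> ps \<beta>)
    have d: "Suc d < length ps" using bot assms(2) by (simp add: length_bot_tuple)
    have "length (drop (Suc d) (snd q)) \<noteq> length [Bot]"
      using d bot by simp
    then have "drop (Suc d) (snd q) \<noteq> [Bot]" by metis
    moreover have "(funs r ! (d + 1)) (take (2 * d + 3) \<tau>) = Some (\<tau> ! (2 * d + 3))"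
      using chain_nth[OF bot(5), of "d + 1"] d bot(4) by (simp add: eval_nat_numeral)
    ultimately show ?thesis
      using d bot by (simp add: nth_annotate nth_append nth_bot_tuple[simplified])
  qed
  then show "d < length (rhs r)"
    and "d < length (snd q)"
    and "snd q ! d = Sym (syms r ! d) (\<tau> ! (2 * d + 1)) (\<tau> ! (2 * d + 2))"
    and "(funs r ! (d + 1)) (take (2 * d + 3) \<tau>) = Some (\<tau> ! (2 * d + 3))"
    and "drop (Suc d) (snd q) \<noteq> [Bot]"
    by blast+
qed

text \<open>In type (i) the length forces \<open>d = k\<close>, leaving no symbol at
  \<open>d\<close>; in type (ii) it forces \<open>h = d + 1\<close>, so only the final
  \<open>Bot\<close> follows.\<close>

lemma expansion_last:
  assumes "(q, \<tau>) \<in> expansion \<Phi> r" "length \<tau> = 2 * d + 2"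
    and "d < length (snd q)"
  shows "drop (Suc d) (snd q) = [Bot]"
  using assms(1)
proof (cases rule: expansion_cases)
  case (full \<alpha> ps \<beta>)
  then show ?thesis using assms(2,3) by simp
next
  case (bot \<alpha> ps \<beta>)
  then have "length ps = Suc d" using assms(2) by (simp add: length_bot_tuple)
  then show ?thesis using bot by simp
qed

section \<open>Membership in \<open>Norm\<close> and \<open>Scan\<close> by dot position\<close>

text \<open>The split of the right-hand side is recovered by \<open>take\<close> and
  \<open>drop\<close> at the dot; the bound on \<open>d\<close> makes the first piece have length
  \<open>d\<close>.\<close>

lemma Norm_iff:
  "(q, d, i, j) \<in> Norm I' \<longleftrightarrow>
     (q, d, i, j) \<in> I' \<and> d \<le> length (snd q) \<and> fst q \<noteq> Top \<and> drop d (snd q) \<noteq> [Bot]"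
proof
  assume R: "(q, d, i, j) \<in> I' \<and> d \<le> length (snd q) \<and> fst q \<noteq> Top \<and> drop d (snd q) \<noteq> [Bot]"
  then have "q = (fst q, take d (snd q) @ drop d (snd q))" "d = length (take d (snd q))"
    by simp_all
  then show "(q, d, i, j) \<in> Norm I'" using R unfolding Norm_def
    by (smt (verit, ccfv_threshold) mem_Collect_eq)
qed (auto simp: Norm_def)

lemma Scan_iff:
  "(q, d', i, j) \<in> Scan T' k I' \<longleftrightarrow>
     (q, d', i, j) \<in> I' \<or>
     (\<exists>d c. d' = Suc d \<and> j = k + length c \<and> (q, d, i, k) \<in> I' \<and> d < length (snd q) \<and>
        (snd q ! d, c) \<in> T')"
  (is "_ \<longleftrightarrow> _ \<or> ?step")
proof
  assume "(q, d', i, j) \<in> Scan T' k I'"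
  then show "(q, d', i, j) \<in> I' \<or> ?step"
    unfolding Scan_def by fastforce
next
  assume "(q, d', i, j) \<in> I' \<or> ?step"
  then show "(q, d', i, j) \<in> Scan T' k I'"
  proof
    assume ?step
    then obtain d c where dc: "d' = Suc d" "j = k + length c" "(q, d, i, k) \<in> I'"
      "d < length (snd q)" "(snd q ! d, c) \<in> T'" by blast
    obtain L w where q: "q = (L, w)" by (cases q)
    have w: "take d w @ [w ! d] @ drop (Suc d) w = w" and l: "length (take d w) = d"
      using dc(4) by (simp_all add: q Cons_nth_drop_Suc)
    then have "(q, d', i, j) = ((L, take d w @ [w ! d] @ drop (Suc d) w),
        length (take d w @ [w ! d]), i, k + length c)"
      and "((L, take d w @ [w ! d] @ drop (Suc d) w), length (take d w), i, k) \<in> I'"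
      using dc q by auto
    then show ?thesis using dc(5) unfolding Scan_def q snd_conv by blast
  qed (simp add: Scan_def)
qed

lemma Sym_in_unparam: "(Sym t \<alpha> \<beta>, c) \<in> unparam T \<longleftrightarrow> (t, \<alpha>, \<beta>, c) \<in> T"
  by (force simp: unparam_def)

lemma Bot_notin_unparam: "(Bot, c) \<notin> unparam T"
  by (auto simp: unparam_def)

section \<open>The two inclusions of similarity after scanning\<close>

theorem theorem9:
  fixes G :: "('s, 'p, 'c) pgrammar"
    and D :: "'c list"
    and k :: nat
    and T :: "('s \<times> 'p \<times> 'p \<times> 'c list) set"
    and I :: "('s, 'p) pitem set"
    and I' :: "('s, 'p) isym item set"
  assumes "wf_pgrammar G"
    and "D \<in> lists (chars G)"
    and "k \<le> length D"
    and "T \<subseteq> ptokens G (length D) k"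
    and "I \<subseteq> pitems G (length D)"
    and "I' \<subseteq> items (induced_grammar G) (length D)"
    and "similar (params G) I I'"
  shows "similar (params G) (pScan T k I) (Scan (unparam T) k I')"
proof -
  let ?\<Phi> = "params G"
  have sim: "items_bar ?\<Phi> I = Norm I'"
    using assms(7) by (simp add: similar_def)
  have len: "length \<rho> = 2 * d + 2" if "(r, d, i, j, \<rho>) \<in> I" for r d i j \<rho>
  proof -
    have "\<rho> \<in> chain ?\<Phi> (take (d + 1) (funs r))" "d \<le> length (rhs r)"
      using that assms(5) by (auto simp: pitems_def)
    then show ?thesis by (auto dest: length_chain)
  qed
  have "x \<in> Norm (Scan (unparam T) k I')" if "x \<in> items_bar ?\<Phi> (pScan T k I)" for x
  proof -
    from that obtain y where y: "y \<in> pScan T k I" "x \<in> item_bar ?\<Phi> y"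
      unfolding items_bar_def by blast
    from y(1) consider "y \<in> I"
      | r d i \<rho> \<beta> c \<gamma> where "y = (r, d + 1, i, k + length c, (\<rho> @ [\<beta>]) @ [\<gamma>])"
        "(r, d, i, k, \<rho>) \<in> I" "(syms r ! d, \<rho> ! (2 * d + 1), \<beta>, c) \<in> T"
      unfolding pScan_def by blast
    then show ?thesis
    proof cases
      case 1
      then have "x \<in> Norm I'" using y(2) sim unfolding items_bar_def by blast
      then show ?thesis by (cases x) (auto simp: Norm_iff Scan_iff)
    next
      case (2 r d i \<rho> \<beta> c \<gamma>)
      note l = len[OF 2(2)]
      have "length (\<rho> @ [\<beta>, \<gamma>]) = 2 * Suc d + 2" using l by simp
      moreover have "x \<in> item_bar ?\<Phi> (r, Suc d, i, k + length c, \<rho> @ [\<beta>, \<gamma>])"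
        using y(2) 2(1) by simp
      ultimately have "x \<in> {(q, Suc d, i, k + length c) | q \<tau>.
          (q, \<tau>) \<in> expansion ?\<Phi> r \<and> take (2 * Suc d + 2) \<tau> = \<rho> @ [\<beta>, \<gamma>]}"
        by (simp only: item_bar_expansion)
      then obtain q \<tau> where
        q: "x = (q, Suc d, i, k + length c)" "(q, \<tau>) \<in> expansion ?\<Phi> r"
        and "take (2 * Suc d + 2) \<tau> = \<rho> @ [\<beta>, \<gamma>]"
        by blast
      moreover have "2 * Suc d + 2 = 2 * d + 4" by simp
      ultimately have t: "take (2 * d + 4) \<tau> = \<rho> @ [\<beta>, \<gamma>]" by metis
      have "length (take (2 * d + 4) \<tau>) = 2 * d + 4" using l t by simp
      then have lt: "2 * d + 4 \<le> length \<tau>" by simp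
      \<comment> \<open>Forgetting \<beta> and \<gamma> shows that the same rule, with the dot one
        place back, expands the scanned item; similarity then puts it into
        \<open>I'\<close>.\<close>
      have pre: "take (2 * d + 2) \<tau> = \<rho>"
        using arg_cong[OF t, of "take (2 * d + 2)"] l by simp
      then have "(q, d, i, k) \<in> item_bar ?\<Phi> (r, d, i, k, \<rho>)"
        using item_bar_expansion[OF l] q(2) by blast
      then have old: "(q, d, i, k) \<in> I'"
        using 2(2) sim Norm_iff unfolding items_bar_def by blast
      \<comment> \<open>The last entry of \<rho> and the token's \<beta> are the superscript and
        subscript of the symbol after the dot, so the unparameterized token matches it.\<close>
      have "\<tau> ! (2 * d + 1) = \<rho> ! (2 * d + 1)"
        using pre by (metis add_less_cancel_left nth_take one_less_numeral_iff semiring_norm(76))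
      moreover have "\<tau> ! (2 * d + 2) = take (2 * d + 4) \<tau> ! (2 * d + 2)" by simp
      then have "\<tau> ! (2 * d + 2) = \<beta>" unfolding t using l by (simp add: nth_append)
      ultimately have "(snd q ! d, c) \<in> unparam T"
        using 2(3) expansion_step(3)[OF q(2) lt] by (simp add: Sym_in_unparam)
      then have "x \<in> Scan (unparam T) k I'"
        using old expansion_step(2)[OF q(2) lt] unfolding q(1) Scan_iff by blast
      then show ?thesis
        using expansion_step(2,5)[OF q(2) lt] expansion_lhs[OF q(2)]
        unfolding q(1) Norm_iff by simp
    qed
  qed
  moreover have "x \<in> items_bar ?\<Phi> (pScan T k I)" if "x \<in> Norm (Scan (unparam T) k I')" for x
  proof -
    obtain q d' i j where x: "x = (q, d', i, j)" by (cases x) auto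
    have n: "fst q \<noteq> Top" "drop d' (snd q) \<noteq> [Bot]" "d' \<le> length (snd q)"
      using that by (auto simp: x Norm_iff)
    from that have "(q, d', i, j) \<in> Scan (unparam T) k I'" by (simp add: x Norm_iff)
    then consider "(q, d', i, j) \<in> I'"
      | d c where "d' = Suc d" "j = k + length c" "(q, d, i, k) \<in> I'" "d < length (snd q)"
        "(snd q ! d, c) \<in> unparam T"
      unfolding Scan_iff by blast
    then show ?thesis
    proof cases
      case 1
      then have "x \<in> items_bar ?\<Phi> I" using n sim by (simp add: x Norm_iff)
      then show ?thesis by (auto simp: items_bar_def pScan_def)
    next
      case (2 d c)
      \<comment> \<open>The scanned symbol comes from a token, so it is not \<open>Bot\<close>.
        Hence the item before the scan survives \<open>Norm\<close> and similarity applies to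
        it.\<close>
      have "drop d (snd q) \<noteq> [Bot]"
        using 2(4,5) Bot_notin_unparam by (metis Cons_nth_drop_Suc list.inject)
      then have "(q, d, i, k) \<in> items_bar ?\<Phi> I"
        using 2 n sim by (simp add: Norm_iff)
      then obtain y where "y \<in> I" "(q, d, i, k) \<in> item_bar ?\<Phi> y"
        unfolding items_bar_def by blast
      \<comment> \<open>Expanding an item keeps its dot and both positions, so only the rule and
        \<rho> remain to be found.\<close>
      moreover from this(2) obtain r \<rho> where "y = (r, d, i, k, \<rho>)"
        by (cases y) (auto simp: item_bar_def)
      ultimately have r: "(r, d, i, k, \<rho>) \<in> I" "(q, d, i, k) \<in> item_bar ?\<Phi> (r, d, i, k, \<rho>)"
        by simp_all
      note l = len[OF r(1)]
      from r(2) obtain \<tau> where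
        t: "(q, \<tau>) \<in> expansion ?\<Phi> r" "take (2 * d + 2) \<tau> = \<rho>"
        unfolding item_bar_expansion[OF l] by blast
      have "2 * d + 2 \<le> length \<tau>" using arg_cong[OF t(2), of length] l by simp
      \<comment> \<open>An exhausted tuple would leave the moved dot directly before a final
        \<open>Bot\<close>, contrary to membership in \<open>Norm\<close>.\<close>
      moreover have "length \<tau> \<noteq> 2 * d + 2"
        using expansion_last[OF t(1)] 2(1,4) n(2) by blast
      ultimately have lt: "2 * d + 4 \<le> length \<tau>"
        using expansion_even[OF t(1)] by presburger
      \<comment> \<open>Both new parameters are read off the tuple of \<open>q\<close>; the chain
        condition makes the second one the value that the parameterized scan appends.\<close>
      let ?\<beta> = "\<tau> ! (2 * d + 2)" and ?\<gamma> = "\<tau> ! (2 * d + 3)"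
      have pre: "take (2 * d + 3) \<tau> = \<rho> @ [?\<beta>]"
        using lt t(2) take_Suc_conv_app_nth[of "2 * d + 2" \<tau>] by (simp add: eval_nat_numeral)
      have pre': "take (2 * Suc d + 2) \<tau> = (\<rho> @ [?\<beta>]) @ [?\<gamma>]"
        using lt pre take_Suc_conv_app_nth[of "2 * d + 3" \<tau>] by (simp add: eval_nat_numeral)
      have "\<tau> ! (2 * d + 1) = \<rho> ! (2 * d + 1)"
        unfolding t(2)[symmetric] by simp
      then have "(syms r ! d, \<rho> ! (2 * d + 1), ?\<beta>, c) \<in> T"
        using 2(5) expansion_step(3)[OF t(1) lt] by (simp add: Sym_in_unparam)
      then have "(r, d + 1, i, k + length c, (\<rho> @ [?\<beta>]) @ [?\<gamma>]) \<in> pScan T k I"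
        using r(1) expansion_step(1,4)[OF t(1) lt] unfolding pScan_def pre by blast
      moreover have "length ((\<rho> @ [?\<beta>]) @ [?\<gamma>]) = 2 * Suc d + 2" using l by simp
      then have "x \<in> item_bar ?\<Phi> (r, Suc d, i, k + length c, (\<rho> @ [?\<beta>]) @ [?\<gamma>])"
        using t(1) pre' unfolding x 2(1,2) by (simp only: item_bar_expansion) blast
      ultimately show ?thesis unfolding items_bar_def Suc_eq_plus1 by blast
    qed
  qed
  ultimately show ?thesis unfolding similar_def by blast
qed

end
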